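(* For every $t\in\mathbb{C}\setminus\{0\}$, every integer $m\ge 0$, and either choice of sign (the same throughout), $$\left.\frac{\partial I_{\nu}(t)}{\partial\nu}\right|_{\nu=\pm m}=(-1)^{m}\left[-K_{m}(t)\pm\frac{m!}{2}\sum_{k=0}^{m-1}\frac{(-1)^{k}I_{k}(t)}{k!\,(m-k)}\left(\frac{t}{2}\right)^{k-m}\right].$$
   Context: $I_\nu(t)=\sum_{k=0}^{\infty}\frac{1}{k!\,\Gamma(k+\nu+1)}\left(\frac{t}{2}\right)^{2k+\nu}$ is the modified Bessel function of the first kind (principal branch, $-\pi<\arg t\le\pi$; $1/\Gamma$ is zero at the poles of $\Gamma$), and $K_\nu(t)=\frac{\pi}{2}\,\frac{I_{-\nu}(t)-I_\nu(t)}{\sin\pi\nu}$ (for integer $\nu$, the limit in $\nu$) is the modified Bessel function of the second kind. Empty sums are $0$. *)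

theory Defs
  imports "HOL-Analysis.Analysis"
begin

text \<open>
  Modified Bessel functions of complex order and complex argument \<open>t \<noteq> 0\<close>.  Complex \<^const>\<open>powr\<close> is
  the principal branch, with imaginary part of \<^const>\<open>Ln\<close> in \<open>(-\<pi>, \<pi>]\<close>, and \<^const>\<open>rGamma\<close>
  is the entire function \<open>1 / \<Gamma>\<close>, zero at the poles of \<open>\<Gamma>\<close>.  The value at \<open>t = 0\<close> carries no
  meaning, because \<open>0 powr a = 0\<close> even for \<open>a = 0\<close>.
\<close>

definition bessel_I :: "complex \<Rightarrow> complex \<Rightarrow> complex" where
  "bessel_I \<nu> t =
     (\<Sum>k. 1 / fact k * rGamma (of_nat k + \<nu> + 1) * (t / 2) powr (2 * of_nat k + \<nu>))"

definition bessel_K_quotient :: "complex \<Rightarrow> complex \<Rightarrow> complex" where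
  "bessel_K_quotient \<nu> t =
     of_real pi / 2 * ((bessel_I (- \<nu>) t - bessel_I \<nu> t) / sin (of_real pi * \<nu>))"

definition bessel_K :: "complex \<Rightarrow> complex \<Rightarrow> complex" where
  "bessel_K \<nu> t =
     (if \<nu> \<in> \<int> then Lim (at \<nu>) (\<lambda>\<mu>. bessel_K_quotient \<mu> t) else bessel_K_quotient \<nu> t)"

end

theory Submission
  imports Defs "HOL-Complex_Analysis.Complex_Analysis"
begin

text \<open>
  Write \<open>D\<close> for the derivative of the entire function \<open>\<nu> \<mapsto> I\<^sub>\<nu>(t)\<close>.  As \<open>I\<^sub>-\<^sub>m = I\<^sub>m\<close>, L'Hospital's rule
  evaluates the limit defining \<open>K\<^sub>m\<close> and gives \<open>D(m) + D(-m) = - 2 (-1)\<^sup>m K\<^sub>m\<close>.  The difference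
  \<open>E\<^sub>m = D(m) - D(-m)\<close> is found by differentiating \<open>I\<^sub>\<nu>\<^sub>-\<^sub>1 - I\<^sub>\<nu>\<^sub>+\<^sub>1 = (2\<nu>/t) I\<^sub>\<nu>\<close> at \<open>\<nu> = \<plusminus>m\<close>, which yields the
  inhomogeneous recurrence \<open>E\<^sub>m\<^sub>-\<^sub>1 - E\<^sub>m\<^sub>+\<^sub>1 = (2m/t) E\<^sub>m + (4/t) I\<^sub>m\<close>; the finite sum satisfies the same
  recurrence, again because of the three-term recurrence for \<open>I\<close>.
\<close>

section \<open>Convergence of the series and holomorphy in the order\<close>

definition bessel_I_term :: "complex \<Rightarrow> nat \<Rightarrow> complex \<Rightarrow> complex" where
  "bessel_I_term t k \<nu> =
     1 / fact k * rGamma (of_nat k + \<nu> + 1) * (t / 2) powr (2 * of_nat k + \<nu>)"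

lemma bessel_I_eq_suminf: "bessel_I \<nu> t = (\<Sum>k. bessel_I_term t k \<nu>)"
  by (simp add: bessel_I_def bessel_I_term_def)

text \<open>Splitting off \<open>(t / 2) powr \<nu>\<close> leaves natural powers of
  \<open>t / 2\<close> with coefficients entire in \<open>\<nu>\<close>.\<close>

lemma bessel_I_term_altdef:
  assumes "t \<noteq> 0"
  shows "bessel_I_term t k \<nu> =
    (t / 2) powr \<nu> * ((t / 2) ^ (2 * k) / fact k * rGamma (of_nat k + \<nu> + 1))"
proof -
  have "(t / 2) powr (2 * of_nat k + \<nu>) = (t / 2) powr of_nat (2 * k) * (t / 2) powr \<nu>"
    by (simp add: powr_add)
  also have "(t / 2) powr of_nat (2 * k) = (t / 2) ^ (2 * k)"
    using assms by (subst powr_nat') auto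
  finally show ?thesis by (simp add: bessel_I_term_def)
qed

lemma holomorphic_rGamma_shift: "(\<lambda>\<nu>. rGamma (c + \<nu> + 1)) holomorphic_on A"
proof -
  have "rGamma \<circ> (\<lambda>\<nu>. c + \<nu> + 1) holomorphic_on A"
    by (intro holomorphic_on_compose holomorphic_intros)
  then show ?thesis by (simp add: o_def)
qed

text \<open>Compactness gives the bound on the disc for a single index \<open>N\<close>. It passes
  from \<open>k\<close> to \<open>k + 1\<close> because \<open>rGamma (x + 1) = rGamma x / x\<close>
  and \<open>x = k + \<nu> + 1\<close> has modulus at least 1 once \<open>k\<close> exceeds
  \<open>R\<close>.\<close>

lemma rGamma_shift_bounded:
  assumes "0 \<le> R"
  obtains M N where "0 \<le> M"
    "\<And>k (\<nu>::complex). N \<le> k \<Longrightarrow> norm \<nu> \<le> R \<Longrightarrow> norm (rGamma (of_nat k + \<nu> + 1)) \<le> M"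
proof -
  define N where "N = nat \<lceil>R\<rceil> + 1"
  have N: "real N \<ge> R + 1" unfolding N_def using assms by linarith
  have "compact ((\<lambda>\<nu>. rGamma (of_nat N + \<nu> + 1 :: complex)) ` cball 0 R)"
    by (intro compact_continuous_image holomorphic_on_imp_continuous_on
        holomorphic_rGamma_shift compact_cball)
  then obtain M where "\<forall>\<nu>\<in>cball 0 R. norm (rGamma (of_nat N + \<nu> + 1 :: complex)) \<le> M"
    by (auto dest!: compact_imp_bounded simp: bounded_iff)
  then have M: "norm (rGamma (of_nat N + \<nu> + 1)) \<le> M" if "norm \<nu> \<le> R" for \<nu> :: complex
    using that by simp
  have bound: "norm (rGamma (of_nat k + \<nu> + 1)) \<le> M" if "N \<le> k" "norm \<nu> \<le> R" for k and \<nu> :: complex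
    using that(1)
  proof (induction k rule: dec_induct)
    case base
    then show ?case using M that(2) by simp
  next
    case (step k)
    let ?x = "of_nat k + \<nu> + 1 :: complex"
    have "real k + 1 - norm \<nu> \<le> norm ?x"
      using norm_diff_ineq[of "of_nat k + 1 :: complex" \<nu>] norm_of_nat[of "Suc k", where 'a = complex]
      by (simp add: add_ac)
    then have x: "1 \<le> norm ?x" using N step.hyps that(2) by linarith
    have "?x * rGamma (?x + 1) = rGamma ?x" by (rule rGamma_plus1)
    then have "norm ?x * norm (rGamma (?x + 1)) \<le> M"
      using step.IH by (metis norm_mult)
    moreover have "1 * norm (rGamma (?x + 1)) \<le> norm ?x * norm (rGamma (?x + 1))"
      using x by (intro mult_right_mono) auto
    ultimately show ?case by (simp add: algebra_simps)
  qed
  have "0 \<le> M" using order_trans[OF norm_ge_zero M[of 0]] assms by simp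
  then show thesis using that bound by blast
qed

text \<open>The majorant is \<open>M\<close> times the exponential series at
  \<open>(norm z)\<^sup>2\<close>. It dominates only from index \<open>N\<close> on, hence the
  eventual form of the M-test.\<close>

lemma rGamma_power_series_uniform_limit:
  fixes z :: complex
  assumes "0 \<le> R"
  shows "uniform_limit (cball 0 R)
    (\<lambda>n \<nu>. \<Sum>k<n. z ^ (2 * k) / fact k * rGamma (of_nat k + \<nu> + 1))
    (\<lambda>\<nu>. \<Sum>k. z ^ (2 * k) / fact k * rGamma (of_nat k + \<nu> + 1)) sequentially"
proof -
  obtain M N where M: "0 \<le> M"
    "\<And>k (\<nu>::complex). N \<le> k \<Longrightarrow> norm \<nu> \<le> R \<Longrightarrow> norm (rGamma (of_nat k + \<nu> + 1)) \<le> M"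
    using rGamma_shift_bounded[OF assms] by blast
  show ?thesis
  proof (rule Weierstrass_m_test_ev)
    show "\<forall>\<^sub>F k in sequentially. \<forall>\<nu>\<in>cball 0 R.
        norm (z ^ (2 * k) / fact k * rGamma (of_nat k + \<nu> + 1)) \<le> (norm z)\<^sup>2 ^ k / fact k * M"
      using eventually_ge_at_top[of N]
    proof eventually_elim
      case (elim k)
      then show ?case
        using M by (auto simp: norm_mult norm_divide norm_power power_mult intro!: mult_left_mono divide_right_mono)
    qed
    have "summable (\<lambda>k. (norm z)\<^sup>2 ^ k / fact k)"
      using summable_exp[of "(norm z)\<^sup>2"] by (simp add: divide_inverse mult.commute)
    then show "summable (\<lambda>k. (norm z)\<^sup>2 ^ k / fact k * M)"
      by (rule summable_mult2)
  qed
qed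

lemma rGamma_power_series_sums:
  fixes z :: complex
  shows "(\<lambda>k. z ^ (2 * k) / fact k * rGamma (of_nat k + \<nu> + 1)) sums
    (\<Sum>k. z ^ (2 * k) / fact k * rGamma (of_nat k + \<nu> + 1))"
  unfolding sums_def
  by (rule tendsto_uniform_limitI[OF rGamma_power_series_uniform_limit[of "norm \<nu>"]]) auto

lemma sums_bessel_I:
  assumes "t \<noteq> 0"
  shows "(\<lambda>k. bessel_I_term t k \<nu>) sums bessel_I \<nu> t"
proof -
  have "summable (\<lambda>k. bessel_I_term t k \<nu>)"
    unfolding bessel_I_term_altdef[OF assms]
    by (intro summable_mult sums_summable[OF rGamma_power_series_sums])
  then show ?thesis by (simp add: bessel_I_eq_suminf summable_sums)
qed

text \<open>The function is \<open>(t / 2) powr \<nu>\<close>, entire in \<open>\<nu>\<close>, times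
  a limit \<open>G\<close> of entire partial sums that is uniform on a disc with \<open>a\<close> in
  its interior.\<close>

lemma bessel_I_has_field_derivative:
  assumes "t \<noteq> 0"
  shows "((\<lambda>\<nu>. bessel_I \<nu> t) has_field_derivative deriv (\<lambda>\<nu>. bessel_I \<nu> t) a) (at a)"
proof -
  define G where "G = (\<lambda>\<nu>. \<Sum>k. (t / 2) ^ (2 * k) / fact k * rGamma (of_nat k + \<nu> + 1))"
  define R where "R = norm a + 1"
  have "continuous_on (cball 0 R) G \<and> G holomorphic_on ball 0 R"
  proof (rule holomorphic_uniform_limit)
    show "\<forall>\<^sub>F n in sequentially.
        continuous_on (cball 0 R) (\<lambda>\<nu>. \<Sum>k<n. (t / 2) ^ (2 * k) / fact k * rGamma (of_nat k + \<nu> + 1)) \<and>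
        (\<lambda>\<nu>. \<Sum>k<n. (t / 2) ^ (2 * k) / fact k * rGamma (of_nat k + \<nu> + 1)) holomorphic_on ball 0 R"
      by (intro always_eventually allI conjI holomorphic_on_imp_continuous_on holomorphic_on_sum
        holomorphic_on_mult holomorphic_on_const holomorphic_rGamma_shift)
    show "uniform_limit (cball 0 R)
        (\<lambda>n \<nu>. \<Sum>k<n. (t / 2) ^ (2 * k) / fact k * rGamma (of_nat k + \<nu> + 1)) G sequentially"
      unfolding G_def R_def by (rule rGamma_power_series_uniform_limit) auto
  qed auto
  then have "G field_differentiable at a"
    by (intro holomorphic_on_imp_differentiable_at[of _ "ball 0 R"]) (auto simp: R_def)
  then have "(\<lambda>\<nu>. (t / 2) powr \<nu> * G \<nu>) field_differentiable at a"
    using assms by (intro field_differentiable_mult)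
      (auto simp: field_differentiable_def intro!: exI derivative_eq_intros)
  moreover have "bessel_I \<nu> t = (t / 2) powr \<nu> * G \<nu>" for \<nu>
  proof -
    have "(\<lambda>k. bessel_I_term t k \<nu>) sums ((t / 2) powr \<nu> * G \<nu>)"
      unfolding bessel_I_term_altdef[OF assms] G_def by (rule sums_mult[OF rGamma_power_series_sums])
    then show ?thesis using sums_bessel_I[OF assms] sums_unique2 by blast
  qed
  ultimately show ?thesis by (simp add: field_differentiable_derivI)
qed

section \<open>Three-term recurrence and reflection at integer order\<close>

lemma bessel_I_recurrence:
  assumes "t \<noteq> 0"
  shows "bessel_I (\<nu> - 1) t - bessel_I (\<nu> + 1) t = 2 * \<nu> / t * bessel_I \<nu> t"
proof -
  \<comment> \<open>Lowering the order multiplies the term by \<open>(k + \<nu>) (2 / t)\<close>;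
    raising it gives the next term times \<open>(k + 1) (2 / t)\<close>. After an index shift the
    parts with \<open>k\<close> cancel and \<open>2 * \<nu> / t\<close> remains.\<close>
  have lower: "bessel_I_term t k (\<nu> - 1) = (of_nat k + \<nu>) * (2 / t) * bessel_I_term t k \<nu>" for k
    using assms unfolding bessel_I_term_altdef[OF assms]
    by (simp add: powr_diff rGamma_plus1[of "of_nat k + \<nu>", symmetric])
  have raise: "bessel_I_term t k (\<nu> + 1) = of_nat (Suc k) * (2 / t) * bessel_I_term t (Suc k) \<nu>" for k
    using assms
    by (simp add: bessel_I_term_altdef[OF assms] powr_add fact_Suc add_ac divide_simps
        power2_eq_square del: of_nat_Suc) (simp add: algebra_simps)
  have "(\<lambda>k. of_nat (Suc k) * (2 / t) * bessel_I_term t (Suc k) \<nu>) sums bessel_I (\<nu> + 1) t"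
    using sums_bessel_I[OF assms, of "\<nu> + 1"] by (simp only: raise)
  \<comment> \<open>The factor \<open>k\<close> kills the term at 0, so the index shift leaves the
    sum unchanged.\<close>
  then have "(\<lambda>k. of_nat k * (2 / t) * bessel_I_term t k \<nu>) sums bessel_I (\<nu> + 1) t"
    by (subst (asm) sums_Suc_iff) simp
  from sums_diff[OF sums_bessel_I[OF assms, of "\<nu> - 1"] this]
  have "(\<lambda>k. 2 * \<nu> / t * bessel_I_term t k \<nu>) sums (bessel_I (\<nu> - 1) t - bessel_I (\<nu> + 1) t)"
    unfolding lower by (simp add: algebra_simps add_divide_distrib)
  then show ?thesis
    using sums_mult[OF sums_bessel_I[OF assms]] sums_unique2 by blast
qed

text \<open>At order \<open>-m\<close> the first \<open>m\<close> terms sit at poles of Gamma and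
  vanish. Shifting the rest by \<open>m\<close> swaps the roles of \<open>k!\<close> and
  \<open>(k + m)!\<close>.\<close>

lemma bessel_I_minus_of_nat:
  assumes "t \<noteq> 0"
  shows "bessel_I (- of_nat m) t = bessel_I (of_nat m) t"
proof -
  have zero: "bessel_I_term t k (- of_nat m) = 0" if "k < m" for k
  proof -
    have "of_nat k + - of_nat m + 1 = (- of_nat (m - Suc k) :: complex)"
      using that by (simp add: of_nat_diff)
    then show ?thesis
      by (simp add: bessel_I_term_def rGamma_eq_zero_iff)
  qed
  have fact: "rGamma (of_nat n + 1 :: complex) = 1 / fact n" for n
    by (metis Gamma_fact add.commute rGamma_inverse_Gamma inverse_eq_divide)
  have shift: "bessel_I_term t (k + m) (- of_nat m) = bessel_I_term t k (of_nat m)" for k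
    using fact[of k] fact[of "k + m"] by (simp add: bessel_I_term_def algebra_simps)
  have "(\<lambda>k. bessel_I_term t (k + m) (- of_nat m)) sums
      (bessel_I (- of_nat m) t - (\<Sum>k<m. bessel_I_term t k (- of_nat m)))"
    by (rule sums_split_initial_segment[OF sums_bessel_I[OF assms]])
  then have "(\<lambda>k. bessel_I_term t k (of_nat m)) sums bessel_I (- of_nat m) t"
    by (simp add: shift zero)
  then show ?thesis using sums_bessel_I[OF assms] sums_unique2 by blast
qed

section \<open>The sum of the derivatives at m and -m\<close>

lemma bessel_K_of_nat:
  assumes "t \<noteq> 0"
  defines "D \<equiv> deriv (\<lambda>\<nu>. bessel_I \<nu> t)"
  shows "bessel_K (of_nat m) t = - ((- 1) ^ m) / 2 * (D (of_nat m) + D (- of_nat m))"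
proof -
  note D = bessel_I_has_field_derivative[OF assms(1), folded D_def]
  define N where "N = (\<lambda>\<mu>. bessel_I (- \<mu>) t - bessel_I \<mu> t)"
  have cos: "cos (of_real pi * of_nat m :: complex) = (- 1) ^ m"
    using cos_npi[of m]
    by (metis cos_of_real mult.commute of_real_1 of_real_minus of_real_mult of_real_of_nat_eq of_real_power)
  have sin: "sin (of_real pi * of_nat m :: complex) = 0"
    using sin_npi[of m]
    by (metis mult.commute of_real_0 of_real_mult of_real_of_nat_eq sin_of_real)
  have "((\<lambda>\<mu>. bessel_I (- \<mu>) t) has_field_derivative D (- of_nat m) * (- 1)) (at (of_nat m))"
    by (rule DERIV_chain2[OF D]) (auto intro!: derivative_eq_intros)
  then have dN: "(N has_field_derivative (- D (- of_nat m) - D (of_nat m))) (at (of_nat m))"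
    unfolding N_def using DERIV_diff[OF _ D] by fastforce
  have dS: "((\<lambda>\<mu>. sin (of_real pi * \<mu> :: complex)) has_field_derivative
      of_real pi * (- 1) ^ m) (at (of_nat m))"
    by (auto intro!: derivative_eq_intros simp: cos)
  \<comment> \<open>\<open>N\<close> vanishes at \<open>m\<close> by the reflection formula, and the
    sine has a simple zero there, so first derivatives determine the limit.\<close>
  have "((\<lambda>\<mu>. N \<mu> / sin (of_real pi * \<mu>)) \<longlongrightarrow>
      (- D (- of_nat m) - D (of_nat m)) / (of_real pi * (- 1) ^ m)) (at (of_nat m))"
    by (rule lhopital_complex_simple[OF dN dS])
      (auto simp: N_def bessel_I_minus_of_nat[OF assms(1)] sin)
  then have "((\<lambda>\<mu>. bessel_K_quotient \<mu> t) \<longlongrightarrow>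
      of_real pi / 2 * ((- D (- of_nat m) - D (of_nat m)) / (of_real pi * (- 1) ^ m))) (at (of_nat m))"
    unfolding bessel_K_quotient_def N_def by (intro tendsto_mult tendsto_const)
  then have "Lim (at (of_nat m)) (\<lambda>\<mu>. bessel_K_quotient \<mu> t) =
      of_real pi / 2 * ((- D (- of_nat m) - D (of_nat m)) / (of_real pi * (- 1) ^ m))"
    by (intro tendsto_Lim) auto
  also have "\<dots> = (- D (- of_nat m) - D (of_nat m)) / (2 * (- 1) ^ m)"
    by simp
  finally show ?thesis
    by (cases "even m") (simp_all add: bessel_K_def diff_divide_distrib add_divide_distrib)
qed

section \<open>The difference of the derivatives at m and -m\<close>

lemma bessel_I_deriv_recurrence:
  assumes "t \<noteq> 0"
  defines "D \<equiv> deriv (\<lambda>\<nu>. bessel_I \<nu> t)"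
  shows "D (a - 1) - D (a + 1) = 2 / t * bessel_I a t + 2 * a / t * D a"
proof -
  note D = bessel_I_has_field_derivative[OF assms(1), folded D_def]
  have "((\<lambda>\<nu>. bessel_I (\<nu> - 1) t) has_field_derivative D (a - 1) * 1) (at a)"
    by (rule DERIV_chain2[OF D]) (auto intro!: derivative_eq_intros)
  moreover have "((\<lambda>\<nu>. bessel_I (\<nu> + 1) t) has_field_derivative D (a + 1) * 1) (at a)"
    by (rule DERIV_chain2[OF D]) (auto intro!: derivative_eq_intros)
  ultimately have "((\<lambda>\<nu>. bessel_I (\<nu> - 1) t - bessel_I (\<nu> + 1) t) has_field_derivative
      D (a - 1) * 1 - D (a + 1) * 1) (at a)"
    by (rule DERIV_diff)
  moreover have "((\<lambda>\<nu>. 2 * \<nu> / t * bessel_I \<nu> t) has_field_derivative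
      2 / t * bessel_I a t + 2 * a / t * D a) (at a)"
    using assms by (auto intro!: derivative_eq_intros D simp: add_divide_distrib mult_ac)
  ultimately show ?thesis
    unfolding bessel_I_recurrence[OF assms(1)] by (auto dest: DERIV_unique)
qed

text \<open>To be used with \<open>x = (t / 2)\<^sup>2\<close> and
  \<open>w k = (t / 2) ^ k * I_k(t)\<close>, so that the hypothesis is the three-term recurrence.
  Substituting it for \<open>x * w k\<close> and reindexing reduces the claim to comparing
  coefficients of each \<open>w k\<close>; the boundary index \<open>n + 1\<close> yields the
  inhomogeneous term.\<close>

lemma weighted_sum_recurrence:
  fixes w :: "nat \<Rightarrow> 'a::field_char_0"
  assumes w: "\<And>k. x * w k = w (k + 2) + of_nat (k + 1) * w (k + 1)"
  defines "U \<equiv> \<lambda>n. fact n * (\<Sum>k<n. (- 1) ^ k * w k / (fact k * of_nat (n - k)))"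
  shows "U (n + 2) = x * U n + of_nat (n + 1) * U (n + 1) - 2 * (- 1) ^ n * w (n + 1)"
proof -
  define q where "q j k = (- 1) ^ k * w k / (fact k * of_nat (j - k))" for j k
  \<comment> \<open>The range is the same for \<open>j = n + 1\<close> and \<open>j = n + 2\<close>:
    it is all of the sum in \<open>U (n + 1)\<close> but omits the last term of the sum in
    \<open>U (n + 2)\<close>.\<close>
  define S where "S j = (\<Sum>k<n + 1. q j k)" for j
  \<comment> \<open>Coefficients of \<open>w k\<close> after substituting the hypothesis for \<open>x * w k\<close> in \<open>x * U n\<close>; writing \<open>1 / (k - 2)!\<close>
    as \<open>k (k - 1) / k!\<close> makes the boundary terms vanish.\<close>
  define g h where
    "g = (\<lambda>k. (- 1) ^ k * (of_nat k * (of_nat k - 1)) * w k / (fact k * of_nat (n + 2 - k)))" and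
    "h = (\<lambda>k. (- 1) ^ k * (of_nat k)\<^sup>2 * w k / (fact k * of_nat (n + 1 - k)))"
  have g: "g (Suc (Suc k)) = (- 1) ^ k * w (k + 2) / (fact k * of_nat (n - k))" for k
    by (simp add: g_def fact_Suc divide_simps del: of_nat_Suc) (simp add: algebra_simps)
  have h: "- h (Suc k) = (- 1) ^ k * (of_nat (k + 1) * w (k + 1)) / (fact k * of_nat (n - k))" for k
    by (simp add: h_def fact_Suc divide_simps power2_eq_square del: of_nat_Suc)
  have g01: "g 0 = 0" "g (Suc 0) = 0" and h0: "h 0 = 0"
    by (simp_all add: g_def h_def)
  have "(\<Sum>k<n. x * ((- 1) ^ k * w k / (fact k * of_nat (n - k)))) =
      (\<Sum>k<n. g (Suc (Suc k)) - h (Suc k))"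
  proof (rule sum.cong[OF refl])
    fix k
    have "x * ((- 1) ^ k * w k / (fact k * of_nat (n - k)))
        = (- 1) ^ k * (x * w k) / (fact k * of_nat (n - k))"
      by simp
    also have "\<dots> = g (Suc (Suc k)) + (- h (Suc k))"
      unfolding w g h by (simp add: distrib_left add_divide_distrib)
    finally show "x * ((- 1) ^ k * w k / (fact k * of_nat (n - k))) = g (Suc (Suc k)) - h (Suc k)"
      by simp
  qed
  also have "\<dots> = (\<Sum>k<n + 2. g k) - (\<Sum>k<n + 1. h k)"
    using g01 h0 by (simp add: sum_subtractf sum.lessThan_Suc_shift del: sum.lessThan_Suc)
  \<comment> \<open>The double shift carries \<open>g\<close> one index further than
    \<open>h\<close>, leaving one boundary term.\<close>
  also have "\<dots> = (\<Sum>k<n + 1. g k - h k) + g (n + 1)"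
    by (simp add: sum_subtractf)
  finally have "x * U n = fact n * ((\<Sum>k<n + 1. g k - h k) + g (n + 1))"
    by (simp only: U_def mult.left_commute[of x] sum_distrib_left[of x])
  also have "(\<Sum>k<n + 1. g k - h k) =
     (\<Sum>k<n + 1. of_nat (n + 1) * (of_nat (n + 2) * q (n + 2) k - of_nat (n + 1) * q (n + 1) k))"
  proof (rule sum.cong[OF refl])
    fix k assume "k \<in> {..<n + 1}"
    then obtain d where n: "n = k + d" by (auto simp: less_Suc_eq_le le_iff_add)
    have "of_nat d + 1 \<noteq> (0 :: 'a)" "of_nat d + 2 \<noteq> (0 :: 'a)"
      using of_nat_neq_0[of d] of_nat_neq_0[of "d + 1"]
      by (simp add: add.commute, metis add_2_eq_Suc' of_nat_add of_nat_neq_0 of_nat_numeral)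
    moreover define c where "c = (- 1) ^ k * w k / fact k"
    \<comment> \<open>With \<open>d = n - k\<close>, writing \<open>k = (n + 2) - (d + 2)\<close> in
      the first product and \<open>k = (n + 1) - (d + 1)\<close> in the square produces the
      right-hand side plus multiples of \<open>c\<close> that cancel.\<close>
    define u v where "u = c / (of_nat d + 2)" and "v = c / (of_nat d + 1)"
    ultimately have "u * (of_nat d + 2) = v * (of_nat d + 1)"
      by simp
    then have "of_nat k * (of_nat k - 1) * u - (of_nat k)\<^sup>2 * v =
        of_nat (n + 1) * (of_nat (n + 2) * u - of_nat (n + 1) * v)"
      unfolding n of_nat_add of_nat_1 of_nat_numeral by algebra
    moreover have "g k = of_nat k * (of_nat k - 1) * u" "h k = (of_nat k)\<^sup>2 * v"
      "q (n + 2) k = u" "q (n + 1) k = v"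
      by (simp_all add: q_def g_def h_def u_def v_def c_def n add_ac mult_ac)
    ultimately show "g k - h k =
        of_nat (n + 1) * (of_nat (n + 2) * q (n + 2) k - of_nat (n + 1) * q (n + 1) k)"
      by (simp only:)
  qed
  also have "\<dots> = of_nat (n + 1) * (of_nat (n + 2) * S (n + 2) - of_nat (n + 1) * S (n + 1))"
    by (simp only: S_def sum_subtractf right_diff_distrib sum_distrib_left)
  finally have xU: "x * U n = fact n *
      (of_nat (n + 1) * (of_nat (n + 2) * S (n + 2) - of_nat (n + 1) * S (n + 1)) + g (n + 1))" .
  define P where "P = (- 1) ^ n * w (n + 1)"
  have top: "fact (n + 1) = (of_nat n + 1) * (fact n :: 'a)"
    "fact (n + 2) = (of_nat n + 2) * (fact (n + 1) :: 'a)"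
    by (simp_all add: fact_Suc add_ac numeral_2_eq_2)
  have "g (n + 1) = - (of_nat (n + 1) * of_nat n * P / fact (n + 1))"
    by (simp add: g_def P_def)
  also have "\<dots> = - (of_nat n * P / fact n)"
    by (simp add: fact_Suc del: of_nat_Suc)
  finally have "fact n * g (n + 1) = - of_nat n * P"
    by simp
  moreover have "U (n + 1) = fact (n + 1) * S (n + 1)"
    by (simp only: U_def S_def q_def)
  moreover have "U (n + 2) = fact (n + 2) * (S (n + 2) - P / fact (n + 1))"
    by (simp add: U_def S_def q_def P_def del: fact_Suc)
  then have "U (n + 2) = fact (n + 2) * S (n + 2) - of_nat (n + 2) * P"
    unfolding top(2) by (simp add: algebra_simps del: fact_Suc)
  \<comment> \<open>The last term of \<open>U (n + 2)\<close> contributes \<open>-(n + 2) P\<close>,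
    the boundary term in \<open>x * U n\<close> contributes \<open>-n P\<close>; their difference is
    \<open>-2 P\<close>.\<close>
  ultimately have "U (n + 2) = x * U n + of_nat (n + 1) * U (n + 1) - 2 * P"
    using xU unfolding top of_nat_add of_nat_1 of_nat_numeral by algebra
  then show ?thesis
    by (simp only: P_def mult.assoc)
qed

text \<open>The factor \<open>(- t / 2) ^ m\<close> clears denominators and alternating signs, so
  that both sides obey one second-order recurrence. They agree at 0 and 1, and induction in steps of
  two concludes.\<close>

lemma bessel_I_deriv_diff:
  fixes t :: complex
  assumes "t \<noteq> 0"
  defines "D \<equiv> deriv (\<lambda>\<nu>. bessel_I \<nu> t)"
  shows "(- t / 2) ^ m * (D (of_nat m) - D (- of_nat m)) =
    fact m * (\<Sum>k<m. (- 1) ^ k * (bessel_I (of_nat k) t * (t / 2) ^ k) / (fact k * of_nat (m - k)))"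
    (is "_ = ?U m")
proof -
  define z where "z = t / 2"
  have z: "z \<noteq> 0" "t = 2 * z" using assms by (simp_all add: z_def)
  define w where "w = (\<lambda>k. bessel_I (of_nat k) t * (t / 2) ^ k)"
  define E where "E = (\<lambda>m. D (of_nat m) - D (- of_nat m))"
  have rec: "z * D (a - 1) - z * D (a + 1) = bessel_I a t + a * D a" for a
  proof -
    have "D (a - 1) - D (a + 1) = (bessel_I a t + a * D a) / z"
      using bessel_I_deriv_recurrence[OF assms(1), folded D_def]
      by (simp add: z_def add_divide_distrib mult_ac)
    then show ?thesis using z(1) by (simp add: field_simps)
  qed
  \<comment> \<open>This is the recurrence at order \<open>k + 1\<close>, multiplied by
    \<open>z ^ (k + 2)\<close>.\<close>
  have w: "z\<^sup>2 * w k = w (k + 2) + of_nat (k + 1) * w (k + 1)" for k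
  proof -
    have I: "z * bessel_I (of_nat k) t =
        z * bessel_I (of_nat (k + 2)) t + of_nat (k + 1) * bessel_I (of_nat (k + 1)) t"
    proof -
      have "bessel_I (of_nat k) t - bessel_I (of_nat (k + 2)) t =
          of_nat (k + 1) / z * bessel_I (of_nat (k + 1)) t"
        using bessel_I_recurrence[OF assms(1), of "of_nat (k + 1)"] by (simp add: z_def add_ac)
      then show ?thesis using z(1) by (simp add: field_simps)
    qed
    have "z\<^sup>2 * w k = z ^ (k + 1) * (z * bessel_I (of_nat k) t)"
      by (simp add: w_def z_def power2_eq_square)
    also have "\<dots> = w (k + 2) + of_nat (k + 1) * w (k + 1)"
      unfolding I by (simp add: w_def z_def algebra_simps)
    finally show ?thesis .
  qed
  have U: "?U (n + 2) = z\<^sup>2 * ?U n + of_nat (n + 1) * ?U (n + 1) - 2 * (- 1) ^ n * w (n + 1)" for n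
    using weighted_sum_recurrence[of "z\<^sup>2" w, OF w, of n] unfolding w_def .
  have E0: "E 0 = 0" by (simp add: E_def)
  \<comment> \<open>At order 0 the term \<open>a * D a\<close> drops out and
    \<open>D (-1) - D 1 = - E 1\<close>.\<close>
  have E1: "z * E 1 = - bessel_I 0 t"
    using rec[of 0] by (simp add: E_def algebra_simps)
  \<comment> \<open>The instances of \<open>rec\<close> at \<open>a = n + 1\<close> and at
    \<open>-a\<close> are added. The \<open>D\<close> terms combine to \<open>a * E (n + 1)\<close>,
    while the two Bessel values coincide by reflection and double.\<close>
  have E2: "z * E (n + 2) = z * E n - of_nat (n + 1) * E (n + 1) - 2 * bessel_I (of_nat (n + 1)) t" for n
  proof -
    define a where "a = (of_nat (n + 1) :: complex)"
    have a: "of_nat (n + 2) = a + 1" "of_nat n = a - 1" "- a - 1 = - (a + 1)" "- a + 1 = - (a - 1)"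
      by (simp_all add: a_def)
    have "z * E (n + 2) =
        z * E n - (z * D (a - 1) - z * D (a + 1)) - (z * D (- a - 1) - z * D (- a + 1))"
      by (simp add: E_def a algebra_simps)
    also have "\<dots> = z * E n - a * E (n + 1) - 2 * bessel_I a t"
      using bessel_I_minus_of_nat[OF assms(1), of "n + 1"] unfolding rec E_def a_def[symmetric]
      by (simp add: algebra_simps)
    finally show ?thesis by (simp only: a_def)
  qed
  have "(- z) ^ m * E m = ?U m"
  proof (induction m rule: induct_nat_012)
    case 0
    show ?case by (simp add: E0)
  next
    case 1
    show ?case using E1 by simp
  next
    case (ge2 n)
    have "(- z) ^ (n + 2) * E (n + 2) = (- z) ^ (n + 1) * - (z * E (n + 2))"
      by simp
    also have "\<dots> = z\<^sup>2 * ((- z) ^ n * E n) + of_nat (n + 1) * ((- z) ^ (n + 1) * E (n + 1))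
        - 2 * (- 1) ^ n * w (n + 1)"
      unfolding E2 w_def z_def[symmetric] power_minus[of z]
      by (simp add: algebra_simps power2_eq_square)
    also have "\<dots> = ?U (n + 2)"
      using ge2 by (simp only: U Suc_eq_plus1)
    finally show ?case by (simp only: add_2_eq_Suc')
  qed
  then show ?thesis by (simp add: z_def E_def)
qed

section \<open>Both signs from half-sum and half-difference\<close>

theorem corollary3p10:
  fixes t s :: complex and m :: nat
  assumes "t \<noteq> 0" and "s = 1 \<or> s = - 1"
  shows "((\<lambda>\<nu>. bessel_I \<nu> t) has_field_derivative
           (- 1) ^ m * (- bessel_K (of_nat m) t
             + s * (fact m / 2) * (\<Sum>k<m. (- 1) ^ k * bessel_I (of_nat k) t
                 / (fact k * (of_nat m - of_nat k)) * (t / 2) powi (int k - int m))))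
         (at (s * of_nat m))"
proof -
  define D where "D = deriv (\<lambda>\<nu>. bessel_I \<nu> t)"
  define S where "S = (\<Sum>k<m. (- 1) ^ k * bessel_I (of_nat k) t
    / (fact k * (of_nat m - of_nat k)) * (t / 2) powi (int k - int m))"
  have z: "t / 2 \<noteq> 0" using assms by simp
  \<comment> \<open>The factor \<open>(t / 2) ^ m\<close> turns the negative exponents
    \<open>k - m\<close> into natural ones, matching the sum in the difference formula.\<close>
  have "(t / 2) ^ m * S =
      (\<Sum>k<m. (- 1) ^ k * (bessel_I (of_nat k) t * (t / 2) ^ k) / (fact k * of_nat (m - k)))"
    unfolding S_def sum_distrib_left
  proof (rule sum.cong[OF refl])
    fix k assume "k \<in> {..<m}"
    then have "of_nat (m - k) = (of_nat m - of_nat k :: complex)"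
      by (simp add: of_nat_diff)
    moreover have "(t / 2) ^ k = (t / 2) ^ m * (t / 2) powi (int k - int m)"
      using z by (simp add: power_int_diff)
    ultimately show "(t / 2) ^ m * ((- 1) ^ k * bessel_I (of_nat k) t
        / (fact k * (of_nat m - of_nat k)) * (t / 2) powi (int k - int m)) =
        (- 1) ^ k * (bessel_I (of_nat k) t * (t / 2) ^ k) / (fact k * of_nat (m - k))"
      by simp
  qed
  then have "(- t / 2) ^ m * (D (of_nat m) - D (- of_nat m)) = (t / 2) ^ m * (fact m * S)"
    unfolding D_def bessel_I_deriv_diff[OF assms(1)] by simp
  moreover have "(- t / 2) ^ m = (t / 2) ^ m * (- 1) ^ m"
    using power_minus[of "t / 2" m] by simp
  ultimately have "(- 1) ^ m * (D (of_nat m) - D (- of_nat m)) = fact m * S"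
    using z by simp
  then have diff: "D (of_nat m) - D (- of_nat m) = (- 1) ^ m * (fact m * S)"
    by (cases "even m") (simp_all add: algebra_simps)
  have sum: "- bessel_K (of_nat m) t = (- 1) ^ m / 2 * (D (of_nat m) + D (- of_nat m))"
    unfolding bessel_K_of_nat[OF assms(1)] D_def by simp
  \<comment> \<open>For \<open>s = 1\<close> or \<open>s = -1\<close>, half-sum plus
    \<open>s\<close> times half-difference selects the value at \<open>s * m\<close>.\<close>
  have "D (s * of_nat m) =
      (D (of_nat m) + D (- of_nat m)) / 2 + s * ((D (of_nat m) - D (- of_nat m)) / 2)"
    using assms(2) by (auto simp: field_simps)
  also have "\<dots> = (- 1) ^ m * (- bessel_K (of_nat m) t + s * (fact m / 2) * S)"
    unfolding sum diff by (cases "even m") (simp_all add: algebra_simps add_divide_distrib)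
  finally show ?thesis
    using bessel_I_has_field_derivative[OF assms(1), of "s * of_nat m"]
    unfolding D_def S_def by simp
qed

end
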